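(* Let $a,b,p,q$ be real numbers with $p^2+4q\neq 0$, let $(w_n)_{n\ge 0}$ be the Horadam sequence $w_0=a$, $w_1=b$, $w_n=pw_{n-1}+qw_{n-2}$ for $n\ge 2$, and let $\widehat{\mathbb{O}G_n}=\mathbb{O}G_n+\mathbb{O}G_{n+1}\epsilon$ be the $n$-th dual Horadam octonion. Let $\alpha=\frac{p+\sqrt{p^2+4q}}{2}$, $\beta=\frac{p-\sqrt{p^2+4q}}{2}$, $A=b-a\beta$, $B=b-a\alpha$. Then for all $n\ge 0$ the norm of $\widehat{\mathbb{O}G_n}$ is $$Nr(\widehat{\mathbb{O}G_{n}})=\left(\mathbb{O}G_{n}\circ\overline{\mathbb{O}G_{n}},\;\mathbb{O}G_{n}\circ\overline{\mathbb{O}G_{n+1}}+\mathbb{O}G_{n+1}\circ\overline{\mathbb{O}G_{n}}\right)=(e_1,e_2),$$ where the (scalar) components $e_1,e_2$ of this pair are $$e_1=\frac{A^2\alpha^{2n}(1+\alpha^2+\alpha^4+\dots+\alpha^{14})+B^2\beta^{2n}(1+\beta^2+\beta^4+\dots+\beta^{14})}{(\alpha-\beta)^2}-L,$$ $$e_2=2\sum_{i=0}^7 w_{n+i}w_{n+1+i},$$ and $$L=\frac{2AB(-q)^n\left(1+(-q)+(-q)^2+\dots+(-q)^7\right)}{(\alpha-\beta)^2}.$$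
   Context: Let $\mathbb{O}$ be the real octonions with basis (written here $\mathbf{e}_0,\dots,\mathbf{e}_7$, to avoid confusion with the scalars $e_1,e_2$ of the claim), where $\mathbf{e}_0=1$ is the identity, $\mathbf{e}_i^2=-1$ and $\mathbf{e}_i\mathbf{e}_j=-\mathbf{e}_j\mathbf{e}_i$ for distinct $i,j\ge 1$, and $\mathbf{e}_i\circ \mathbf{e}_j=\mathbf{e}_k$ whenever $(i,j,k)$ is a cyclic permutation of one of $(1,2,3),(1,4,5),(1,7,6),(2,4,6),(2,5,7),(3,4,7),(3,6,5)$; $\circ$ denotes octonion multiplication and $\overline{k}$ octonion conjugation (fixing $\mathbf{e}_0$ and negating $\mathbf{e}_1,\dots,\mathbf{e}_7$). The $n$-th Horadam octonion is $\mathbb{O}G_n=w_n\mathbf{e}_0+w_{n+1}\mathbf{e}_1+\dots+w_{n+7}\mathbf{e}_7$. A dual octonion is $\widehat K=(k,l)=k+l\epsilon$ with $k,l\in\mathbb{O}$, where $\epsilon\ne 0$, $\epsilon^2=0$; multiplication is $(k,l)(m,n)=(k\circ m,\;k\circ n+l\circ m)$, the conjugate is $\overline{\widehat K}=(\overline{k},\overline{l})$, and the norm is $Nr(\widehat K)=\widehat K\,\overline{\widehat K}=(k\circ\overline{k},\;k\circ\overline{l}+l\circ\overline{k})$. The dual Horadam octonion is $\widehat{\mathbb{O}G_n}=(\mathbb{O}G_n,\mathbb{O}G_{n+1})=\mathbb{O}G_n+\mathbb{O}G_{n+1}\epsilon$. Real scalars are identified with multiples of the identity $\mathbf{e}_0$;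 $\alpha,\beta$ may be complex, in which case the formula for $e_1$ is computed in $\mathbb{C}$. *)

theory Defs
  imports Complex_Main
begin

section \<open>Octonions\<close>

text \<open>An octonion is its coordinate family with respect to \<open>e\<^sub>0, ..., e\<^sub>7\<close>, padded with zeros.\<close>

typedef octonion = "{x :: nat \<Rightarrow> real. \<forall>i\<ge>8. x i = 0}"
  morphisms oct_coord Abs_octonion
  by (rule exI[of _ "\<lambda>_. 0"]) simp

setup_lifting type_definition_octonion

lemma oct_eqI: "x = y" if "\<And>i. i < 8 \<Longrightarrow> oct_coord x i = oct_coord y i"
  using that by transfer (auto simp: fun_eq_iff, metis not_le)

instantiation octonion :: real_vector
begin
lift_definition zero_octonion :: octonion is "\<lambda>_. 0" by simp
lift_definition plus_octonion :: "octonion \<Rightarrow> octonion \<Rightarrow> octonion" is "\<lambda>x y i. x i + y i" by simp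
lift_definition minus_octonion :: "octonion \<Rightarrow> octonion \<Rightarrow> octonion" is "\<lambda>x y i. x i - y i" by simp
lift_definition uminus_octonion :: "octonion \<Rightarrow> octonion" is "\<lambda>x i. - x i" by simp
lift_definition scaleR_octonion :: "real \<Rightarrow> octonion \<Rightarrow> octonion" is "\<lambda>r x i. r * x i" by simp
instance
  by standard (transfer; simp add: fun_eq_iff algebra_simps)+
end

lift_definition oct_basis :: "nat \<Rightarrow> octonion"
  is "\<lambda>i k. if k = i \<and> i < 8 then 1 else 0" by simp

definition oct_triples :: "(nat \<times> nat \<times> nat) set" where
  "oct_triples = {(1,2,3), (1,4,5), (1,7,6), (2,4,6), (2,5,7), (3,4,7), (3,6,5)}"

definition oct_cyclic :: "nat \<Rightarrow> nat \<Rightarrow> nat \<Rightarrow> bool" where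
  "oct_cyclic i j k \<longleftrightarrow>
     (i,j,k) \<in> oct_triples \<or> (j,k,i) \<in> oct_triples \<or> (k,i,j) \<in> oct_triples"

text \<open>Structure constants: the product of the basis elements number \<open>i\<close> and \<open>j\<close> has
  \<open>oct_struct i j k\<close> as its coefficient at the basis element number \<open>k\<close>.\<close>

definition oct_struct :: "nat \<Rightarrow> nat \<Rightarrow> nat \<Rightarrow> real" where
  "oct_struct i j k =
     (if i = 0 then (if k = j then 1 else 0)
      else if j = 0 then (if k = i then 1 else 0)
      else if i = j then (if k = 0 then -1 else 0)
      else if oct_cyclic i j k then 1
      else if oct_cyclic j i k then -1
      else 0)"

text \<open>Octonion multiplication is not associative, so none of the ring classes apply.\<close>

instantiation octonion :: "{one, times}"
begin
definition one_octonion :: octonion where "one_octonion = oct_basis 0"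
lift_definition times_octonion :: "octonion \<Rightarrow> octonion \<Rightarrow> octonion"
  is "\<lambda>x y k. if k < 8 then \<Sum>i<8. \<Sum>j<8. x i * y j * oct_struct i j k else 0" by simp
instance ..
end

lift_definition oct_cnj :: "octonion \<Rightarrow> octonion"
  is "\<lambda>x i. if i = 0 then x i else - x i" by simp

lemma oct_basis_mult:
  assumes "i < 8" "j < 8"
  shows "oct_coord (oct_basis i * oct_basis j) k = (if k < 8 then oct_struct i j k else 0)"
proof -
  have "(\<Sum>i'<8. \<Sum>j'<8. (if i' = i \<and> i < 8 then 1 else 0) * (if j' = j \<and> j < 8 then 1 else 0)
           * oct_struct i' j' k)
      = (\<Sum>i'<8. \<Sum>j'<8. if i' = i then if j' = j then oct_struct i j k else 0 else 0)"
    using assms by (intro sum.cong refl) simp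
  also have "\<dots> = (\<Sum>i'<8. if i' = i then oct_struct i j k else 0)"
    using assms by (intro sum.cong refl) (simp add: sum.delta)
  also have "\<dots> = oct_struct i j k"
    using assms by (simp add: sum.delta)
  finally show ?thesis
    by transfer simp
qed

lemma oct_mult_one [simp]: "1 * x = x" "x * 1 = (x :: octonion)"
proof -
  show "1 * x = x"
  proof (rule oct_eqI)
    fix k :: nat assume k: "k < 8"
    have "oct_coord (1 * x) k = (\<Sum>i<8. \<Sum>j<8. oct_coord 1 i * oct_coord x j * oct_struct i j k)"
      using k by (simp add: times_octonion.rep_eq)
    also have "\<dots> = (\<Sum>i<8::nat. if i = 0 then \<Sum>j<8. if k = j then oct_coord x j else 0 else 0)"
      by (intro sum.cong refl)
         (simp add: one_octonion_def oct_basis.rep_eq oct_struct_def if_distrib[of "(*) _"] cong: if_cong)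
    also have "\<dots> = oct_coord x k"
      using k by (simp add: sum.delta)
    finally show "oct_coord (1 * x) k = oct_coord x k" .
  qed
  show "x * 1 = x"
  proof (rule oct_eqI)
    fix k :: nat assume k: "k < 8"
    have "oct_coord (x * 1) k = (\<Sum>i<8. \<Sum>j<8. oct_coord x i * oct_coord 1 j * oct_struct i j k)"
      using k by (simp add: times_octonion.rep_eq)
    also have "\<dots> = (\<Sum>i<8. \<Sum>j<8::nat. if j = 0 then if k = i then oct_coord x i else 0 else (0::real))"
      by (intro sum.cong refl)
         (simp add: one_octonion_def oct_basis.rep_eq oct_struct_def)
    also have "\<dots> = oct_coord x k"
      using k by (simp add: sum.delta)
    finally show "oct_coord (x * 1) k = oct_coord x k" .
  qed
qed

lemma oct_basis_square:
  assumes "1 \<le> i" "i < 8"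
  shows "oct_basis i * oct_basis i = - 1"
  using assms
  by (intro oct_eqI)
     (auto simp: oct_basis_mult oct_struct_def one_octonion_def uminus_octonion.rep_eq oct_basis.rep_eq)

lemma oct_cyclic_iff:
  "oct_cyclic i j k \<longleftrightarrow> (i,j,k) \<in>
      {(1,2,3), (2,3,1), (3,1,2),
       (1,4,5), (4,5,1), (5,1,4),
       (1,7,6), (7,6,1), (6,1,7),
       (2,4,6), (4,6,2), (6,2,4),
       (2,5,7), (5,7,2), (7,2,5),
       (3,4,7), (4,7,3), (7,3,4),
       (3,6,5), (6,5,3), (5,3,6)}"
  unfolding oct_cyclic_def oct_triples_def insert_iff empty_iff prod.inject by argo

lemma oct_cyclic_facts:
  assumes "oct_cyclic i j k"
  shows "1 \<le> i \<and> i < 8 \<and> 1 \<le> j \<and> j < 8 \<and> k < 8 \<and> i \<noteq> j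
    \<and> (\<forall>k'. \<not> oct_cyclic j i k') \<and> (\<forall>k'. oct_cyclic i j k' \<longrightarrow> k' = k)"
  using assms unfolding oct_cyclic_iff[of i j k] insert_iff empty_iff prod.inject
  by (elim disjE conjE FalseE; hypsubst; simp add: oct_cyclic_iff)

lemma oct_basis_anticommute:
  assumes "1 \<le> i" "i < 8" "1 \<le> j" "j < 8" "i \<noteq> j"
  shows "oct_basis i * oct_basis j = - (oct_basis j * oct_basis i)"
  using assms oct_cyclic_facts
  by (intro oct_eqI) (auto simp: oct_basis_mult oct_struct_def uminus_octonion.rep_eq)

lemma oct_basis_cyclic:
  assumes "oct_cyclic i j k"
  shows "oct_basis i * oct_basis j = oct_basis k"
proof (rule oct_eqI)
  fix m :: nat assume m: "m < 8"
  note facts = oct_cyclic_facts[OF assms]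
  have cyc: "oct_cyclic i j m \<longleftrightarrow> m = k" "\<not> oct_cyclic j i m"
    using facts assms by blast+
  have bounds: "i < 8" "j < 8" "k < 8" "i \<noteq> 0" "j \<noteq> 0" "i \<noteq> j"
    using facts by auto
  show "oct_coord (oct_basis i * oct_basis j) m = oct_coord (oct_basis k) m"
    using m bounds by (simp add: oct_basis_mult oct_struct_def oct_basis.rep_eq cyc)
qed


section \<open>Dual octonions\<close>

text \<open>\<open>Dual k l\<close> stands for \<open>k + l \<epsilon>\<close>.\<close>

datatype dual_octonion = Dual octonion octonion

instantiation dual_octonion :: "{zero, plus, times}"
begin
definition zero_dual_octonion :: dual_octonion where "zero_dual_octonion = Dual 0 0"
fun plus_dual_octonion :: "dual_octonion \<Rightarrow> dual_octonion \<Rightarrow> dual_octonion" where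
  "Dual k l + Dual m n = Dual (k + m) (l + n)"
fun times_dual_octonion :: "dual_octonion \<Rightarrow> dual_octonion \<Rightarrow> dual_octonion" where
  "Dual k l * Dual m n = Dual (k * m) (k * n + l * m)"
instance ..
end

definition dual_eps :: dual_octonion where
  "dual_eps = Dual 0 1"

fun dual_cnj :: "dual_octonion \<Rightarrow> dual_octonion" where
  "dual_cnj (Dual k l) = Dual (oct_cnj k) (oct_cnj l)"

definition dual_Nr :: "dual_octonion \<Rightarrow> dual_octonion" where
  "dual_Nr K = K * dual_cnj K"

lemma oct_mult_zero [simp]: "0 * x = 0" "x * 0 = (0 :: octonion)"
  by (transfer, simp add: fun_eq_iff)+

lemma dual_eps_nonzero: "dual_eps \<noteq> 0"
  by (simp add: dual_eps_def zero_dual_octonion_def one_octonion_def, transfer)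
     (auto simp: fun_eq_iff)

lemma dual_eps_square: "dual_eps * dual_eps = 0"
  by (simp add: dual_eps_def zero_dual_octonion_def)

lemma Dual_eq_eps: "Dual k l = Dual k 0 + Dual l 0 * dual_eps"
  by (simp add: dual_eps_def)


section \<open>Horadam sequence and Horadam octonions\<close>

fun horadam :: "real \<Rightarrow> real \<Rightarrow> real \<Rightarrow> real \<Rightarrow> nat \<Rightarrow> real" where
  "horadam a b p q 0 = a"
| "horadam a b p q (Suc 0) = b"
| "horadam a b p q (Suc (Suc n)) = p * horadam a b p q (Suc n) + q * horadam a b p q n"

definition horadam_oct :: "real \<Rightarrow> real \<Rightarrow> real \<Rightarrow> real \<Rightarrow> nat \<Rightarrow> octonion" where
  "horadam_oct a b p q n = (\<Sum>i<8. horadam a b p q (n + i) *\<^sub>R oct_basis i)"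

definition dual_horadam_oct :: "real \<Rightarrow> real \<Rightarrow> real \<Rightarrow> real \<Rightarrow> nat \<Rightarrow> dual_octonion" where
  "dual_horadam_oct a b p q n = Dual (horadam_oct a b p q n) (horadam_oct a b p q (n + 1))"

end

theory Submission
  imports Defs
begin

text \<open>Conjugation makes the antisymmetric part of the octonion product cancel, so
  \<open>x * oct_cnj y + y * oct_cnj x\<close> is twice the Euclidean inner product of \<open>x\<close> and \<open>y\<close>. Both components
  of the norm are therefore real. The formula for the first one follows by squaring Binet's formula
  \<open>w\<^sub>m = (A \<alpha>\<^sup>m - B \<beta>\<^sup>m) / (\<alpha> - \<beta>)\<close>, in which the cross terms are powers of \<open>\<alpha> \<beta> = - q\<close>.\<close>

text \<open>The factors \<open>1\<close> and \<open>-1\<close> are the signs from conjugating the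
  second factor. For distinct nonzero indices the signs agree and anticommutativity cancels the
  terms; if exactly one index is \<open>0\<close>, the two products agree and the signs are
  opposite. Only the diagonal survives. \<open>oct_cyclic_facts\<close> rules out that
  \<open>(i, j, k)\<close> and \<open>(j, i, k)\<close> are both cyclic.\<close>

lemma oct_struct_cnj_symmetrized:
  "oct_struct i j k * (if j = 0 then 1 else -1) + oct_struct j i k * (if i = 0 then 1 else -1) =
     (if i = j \<and> k = 0 then 2 else 0)"
  using oct_cyclic_facts[of i j k] oct_cyclic_facts[of j i k]
  by (auto simp: oct_struct_def)

lemma oct_mult_cnj_symmetrized:
  "x * oct_cnj y + y * oct_cnj x = (2 * (\<Sum>i<8. oct_coord x i * oct_coord y i)) *\<^sub>R 1"
proof (rule oct_eqI)
  fix k :: nat assume k: "k < 8"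
  \<comment> \<open>Absorbing the sign of conjugation into the structure constants makes each
    product a bilinear form in the original coordinates.\<close>
  define t where "t i j = oct_struct i j k * (if j = 0 then 1 else -1)" for i j
  have prod: "oct_coord (u * oct_cnj v) k = (\<Sum>i<8. \<Sum>j<8. oct_coord u i * oct_coord v j * t i j)"
    for u v
    using k unfolding times_octonion.rep_eq oct_cnj.rep_eq t_def
    by (auto intro!: sum.cong)
  \<comment> \<open>The indices of the second double sum are interchanged, so that both sums carry
    the same coordinate product and \<open>t\<close> gets symmetrized.\<close>
  have "oct_coord (x * oct_cnj y + y * oct_cnj x) k =
      (\<Sum>i<8. \<Sum>j<8. oct_coord x i * oct_coord y j * t i j) +
      (\<Sum>i<8. \<Sum>j<8. oct_coord y j * oct_coord x i * t j i)"
    by (subst (2) sum.swap) (simp add: plus_octonion.rep_eq prod)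
  also have "\<dots> = (\<Sum>i<8. \<Sum>j<8. oct_coord x i * oct_coord y j * (t i j + t j i))"
    by (simp add: sum.distrib[symmetric] algebra_simps)
  also have "\<dots> = (\<Sum>i<8. \<Sum>j<8. if j = i then
      (if k = 0 then 2 * (oct_coord x i * oct_coord y i) else 0) else 0)"
    unfolding t_def oct_struct_cnj_symmetrized by (intro sum.cong refl) auto
  also have "\<dots> = (if k = 0 then 2 * (\<Sum>i<8. oct_coord x i * oct_coord y i) else 0)"
    by (simp add: sum_distrib_left)
  finally show "oct_coord (x * oct_cnj y + y * oct_cnj x) k =
      oct_coord ((2 * (\<Sum>i<8. oct_coord x i * oct_coord y i)) *\<^sub>R 1) k"
    by (simp add: scaleR_octonion.rep_eq one_octonion_def oct_basis.rep_eq)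
qed

text \<open>The case \<open>y = x\<close> of the symmetrized identity, with the scalar 2 cancelled
  in the real vector space.\<close>

lemma oct_mult_cnj_self: "x * oct_cnj x = (\<Sum>i<8. (oct_coord x i)\<^sup>2) *\<^sub>R 1"
proof -
  have "2 *\<^sub>R (x * oct_cnj x) = (2 * (\<Sum>i<8. (oct_coord x i)\<^sup>2)) *\<^sub>R 1"
    using oct_mult_cnj_symmetrized[of x x] by (simp add: scaleR_2 power2_eq_square)
  also have "\<dots> = 2 *\<^sub>R ((\<Sum>i<8. (oct_coord x i)\<^sup>2) *\<^sub>R 1)"
    by (rule scaleR_scaleR[symmetric])
  finally show ?thesis
    unfolding scaleR_cancel_left by simp
qed

lemma oct_coord_sum: "oct_coord (\<Sum>i\<in>S. f i) k = (\<Sum>i\<in>S. oct_coord (f i) k)"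
  by (induction S rule: infinite_finite_induct)
     (simp_all add: zero_octonion.rep_eq plus_octonion.rep_eq)

lemma oct_coord_horadam_oct:
  assumes "k < 8"
  shows "oct_coord (horadam_oct a b p q n) k = horadam a b p q (n + k)"
proof -
  have "oct_coord (horadam_oct a b p q n) k = (\<Sum>i<8. if k = i then horadam a b p q (n + i) else 0)"
    unfolding horadam_oct_def oct_coord_sum
    by (intro sum.cong refl) (simp add: scaleR_octonion.rep_eq oct_basis.rep_eq)
  with assms show ?thesis by simp
qed

text \<open>Both sides satisfy the same second-order recurrence and agree at 0 and 1. Multiplying by
  \<open>\<alpha> - \<beta>\<close> avoids division, and prescribing the sum and product of the
  roots avoids square roots.\<close>

lemma horadam_Binet:
  fixes \<alpha> \<beta> :: "'a::real_field"
  assumes "\<alpha> + \<beta> = of_real p" and "\<alpha> * \<beta> = - of_real q"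
  shows "(\<alpha> - \<beta>) * of_real (horadam a b p q n) =
    (of_real b - of_real a * \<beta>) * \<alpha> ^ n - (of_real b - of_real a * \<alpha>) * \<beta> ^ n"
proof (induction n rule: induct_nat_012)
  case (ge2 n)
  \<comment> \<open>By Vieta, \<alpha> and \<beta> are the roots of the characteristic polynomial,
    so their powers obey the Horadam recurrence.\<close>
  have root: "x * x = of_real p * x + of_real q" if "x = \<alpha> \<or> x = \<beta>" for x
  proof -
    have "(x - \<alpha>) * (x - \<beta>) = 0" using that by auto
    then have "x * x = (\<alpha> + \<beta>) * x - \<alpha> * \<beta>" by (simp add: algebra_simps)
    with assms show ?thesis by simp
  qed
  have "x ^ Suc (Suc n) = of_real p * x ^ Suc n + of_real q * x ^ n" if "x = \<alpha> \<or> x = \<beta>" for x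
    using root[OF that] by (simp add: distrib_right flip: mult.assoc)
  then have step: "\<alpha> ^ Suc (Suc n) = of_real p * \<alpha> ^ Suc n + of_real q * \<alpha> ^ n"
      "\<beta> ^ Suc (Suc n) = of_real p * \<beta> ^ Suc n + of_real q * \<beta> ^ n"
    by auto
  have "(\<alpha> - \<beta>) * of_real (horadam a b p q (Suc (Suc n))) =
      of_real p * ((\<alpha> - \<beta>) * of_real (horadam a b p q (Suc n))) +
      of_real q * ((\<alpha> - \<beta>) * of_real (horadam a b p q n))"
    by (simp add: algebra_simps)
  also have "\<dots> = (of_real b - of_real a * \<beta>) * \<alpha> ^ Suc (Suc n) -
      (of_real b - of_real a * \<alpha>) * \<beta> ^ Suc (Suc n)"
    unfolding ge2.IH step by (simp add: algebra_simps)
  finally show ?case .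
qed (simp_all add: algebra_simps)

theorem theorem3p5:
  fixes a b p q :: real and n :: nat and w :: "nat \<Rightarrow> real"
    and \<alpha> \<beta> A B L :: complex and G :: "nat \<Rightarrow> octonion"
  assumes "p\<^sup>2 + 4 * q \<noteq> 0"
    and "w = horadam a b p q"
    and "G = horadam_oct a b p q"
    and "\<alpha> = (of_real p + csqrt (of_real (p\<^sup>2 + 4 * q))) / 2"
    and "\<beta> = (of_real p - csqrt (of_real (p\<^sup>2 + 4 * q))) / 2"
    and "A = of_real b - of_real a * \<beta>"
    and "B = of_real b - of_real a * \<alpha>"
    and "L = 2 * A * B * (- of_real q) ^ n * (\<Sum>i=0..7. (- of_real q) ^ i) / (\<alpha> - \<beta>)\<^sup>2"
  shows "dual_Nr (dual_horadam_oct a b p q n) =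
           Dual (G n * oct_cnj (G n)) (G n * oct_cnj (G (n + 1)) + G (n + 1) * oct_cnj (G n)) \<and>
         (\<exists>e1 e2 :: real.
            Dual (G n * oct_cnj (G n)) (G n * oct_cnj (G (n + 1)) + G (n + 1) * oct_cnj (G n)) =
              Dual (e1 *\<^sub>R 1) (e2 *\<^sub>R 1) \<and>
            complex_of_real e1 =
              (A\<^sup>2 * \<alpha> ^ (2 * n) * (\<Sum>i=0..7. \<alpha> ^ (2 * i))
               + B\<^sup>2 * \<beta> ^ (2 * n) * (\<Sum>i=0..7. \<beta> ^ (2 * i))) / (\<alpha> - \<beta>)\<^sup>2 - L \<and>
            e2 = 2 * (\<Sum>i=0..7. w (n + i) * w (n + 1 + i)))"
proof -
  define d where "d = csqrt (of_real (p\<^sup>2 + 4 * q))"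
  have d2: "d\<^sup>2 = of_real p ^ 2 + 4 * of_real q"
    by (simp add: d_def)
  have "d\<^sup>2 \<noteq> 0"
    unfolding d_def power2_csqrt using assms(1) by (simp only: of_real_eq_0_iff not_False_eq_True)
  have ab: "\<alpha> = (of_real p + d) / 2" "\<beta> = (of_real p - d) / 2"
    using assms(4,5) by (simp_all add: d_def)
  \<comment> \<open>Here \<alpha> - \<beta> equals \<open>d\<close>, a square root of the nonzero
    discriminant.\<close>
  have diff: "(\<alpha> - \<beta>)\<^sup>2 \<noteq> 0"
    using \<open>d\<^sup>2 \<noteq> 0\<close> by (simp add: ab field_simps)
  have sum: "\<alpha> + \<beta> = of_real p"
    by (simp add: ab field_simps)
  have "4 * (\<alpha> * \<beta>) = of_real p ^ 2 - d\<^sup>2"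
    by (simp add: ab field_simps power2_eq_square)
  then have prod: "\<alpha> * \<beta> = - of_real q"
    by (simp add: d2)
  have sq: "(\<alpha> - \<beta>)\<^sup>2 * of_real (w m) ^ 2 =
      A\<^sup>2 * \<alpha> ^ (2 * m) + B\<^sup>2 * \<beta> ^ (2 * m) - 2 * A * B * (- of_real q) ^ m" for m
  proof -
    have "(\<alpha> - \<beta>)\<^sup>2 * of_real (w m) ^ 2 = (A * \<alpha> ^ m - B * \<beta> ^ m)\<^sup>2"
      using horadam_Binet[OF sum prod, of a b m] assms(2,6,7) by (simp flip: power_mult_distrib)
    then show ?thesis
      by (simp add: power2_diff power_mult_distrib mult_ac flip: prod power_mult)
  qed
  \<comment> \<open>The witnesses: the squared Euclidean length of \<open>G n\<close>, and twice the
    inner product of \<open>G n\<close> with \<open>G (n + 1)\<close>.\<close>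
  define e1 where "e1 = (\<Sum>i<8. (w (n + i))\<^sup>2)"
  define e2 where "e2 = 2 * (\<Sum>i<8. w (n + i) * w (n + 1 + i))"
  \<comment> \<open>Apply \<open>sq\<close> at \<open>m = n + i\<close> and sum over
    \<open>i\<close>; splitting each power at \<open>n\<close> leaves three geometric sums with
    ratios \<open>\<alpha>\<^sup>2\<close>, \<open>\<beta>\<^sup>2\<close> and
    \<open>-q\<close>.\<close>
  have "(\<alpha> - \<beta>)\<^sup>2 * of_real e1 =
      A\<^sup>2 * \<alpha> ^ (2 * n) * (\<Sum>i<8. \<alpha> ^ (2 * i)) + B\<^sup>2 * \<beta> ^ (2 * n) * (\<Sum>i<8. \<beta> ^ (2 * i)) -
      2 * A * B * (- of_real q) ^ n * (\<Sum>i<8. (- of_real q) ^ i)"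
    by (simp only: e1_def of_real_sum of_real_power sum_distrib_left sq sum.distrib sum_subtractf
        add_mult_distrib2 power_add mult.assoc)
  moreover have "{..<8} = {0..7::nat}"
    by auto
  ultimately have e1: "complex_of_real e1 =
      (A\<^sup>2 * \<alpha> ^ (2 * n) * (\<Sum>i=0..7. \<alpha> ^ (2 * i)) + B\<^sup>2 * \<beta> ^ (2 * n) * (\<Sum>i=0..7. \<beta> ^ (2 * i)))
        / (\<alpha> - \<beta>)\<^sup>2 - L"
    using diff unfolding assms(8) diff_divide_distrib[symmetric]
    by (simp add: eq_divide_eq mult.commute)
  have e2: "e2 = 2 * (\<Sum>i=0..7. w (n + i) * w (n + 1 + i))"
    unfolding e2_def by (intro arg_cong[where f = "(*) 2"] sum.cong) auto
  have "G n * oct_cnj (G n) = e1 *\<^sub>R 1"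
    by (simp add: oct_mult_cnj_self e1_def assms(2,3) oct_coord_horadam_oct)
  moreover have "G n * oct_cnj (G (n + 1)) + G (n + 1) * oct_cnj (G n) = e2 *\<^sub>R 1"
    unfolding oct_mult_cnj_symmetrized e2_def
    by (simp add: assms(2,3) oct_coord_horadam_oct)
  moreover have "dual_Nr (dual_horadam_oct a b p q n) =
      Dual (G n * oct_cnj (G n)) (G n * oct_cnj (G (n + 1)) + G (n + 1) * oct_cnj (G n))"
    by (simp add: dual_Nr_def dual_horadam_oct_def assms(3))
  ultimately show ?thesis
    using e1 e2 by auto
qed

end
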